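(* Any set $X$ of $n$ points in general position in $\mathbb{R}^3$ is contained in a set $S$ of $2n$ points in general position in $\mathbb{R}^3$ such that $S$ determines at least $\binom{n}{2}$ pairwise interior-disjoint $3$-simplices (each with vertices in $S$).
   Context: General position in $\mathbb{R}^3$: every subset of at most $4$ points is affinely independent. *)

theory Defs
  imports "HOL-Analysis.Analysis"
begin

definition general_position :: "(real ^ 3) set \<Rightarrow> bool" where
  "general_position S \<longleftrightarrow> (\<forall>T\<subseteq>S. finite T \<and> card T \<le> 4 \<longrightarrow> \<not> affine_dependent T)"

text \<open>The solid 3-simplices (cf. \<^const>\<open>simplex\<close>) all of whose vertices lie in \<open>S\<close>.\<close>

definition simplices_on :: "(real ^ 3) set \<Rightarrow> (real ^ 3) set set" where
  "simplices_on S = {convex hull T | T. T \<subseteq> S \<and> \<not> affine_dependent T \<and> card T = 4}"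

end

theory Submission
  imports Defs
begin

text \<open>
  Next to each point \<open>x\<close> of \<open>X\<close> put a new point \<open>y x = x + t d\<^sub>x\<close>, with a generic direction \<open>d\<^sub>x\<close> and a
  small \<open>t > 0\<close>, and assign to each pair \<open>{i, j}\<close> the thin tetrahedron with vertices
  \<open>i, y i, j, y j\<close> around the segment from \<open>i\<close> to \<open>j\<close>. For disjoint pairs the segments are disjoint,
  because no four points of \<open>X\<close> are coplanar, and a plane strictly separating them also separates the
  tetrahedra. For two pairs \<open>{i, j}\<close> and \<open>{i, k}\<close>, since \<open>d\<^sub>i\<close> is not parallel to the plane \<open>ijk\<close>, some
  plane through \<open>i\<close> and \<open>y i\<close> has \<open>j, y j\<close> strictly on one side and \<open>k, y k\<close> strictly on the other.
  All these conditions are open in \<open>y\<close>, so the points \<open>y x\<close> can finally be moved one at a time to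
  achieve general position.
\<close>

section \<open>Generic choice of a further point\<close>

lemma open_not_covered_by_negligible:
  fixes U :: "'a::euclidean_space set"
  assumes "open U" "U \<noteq> {}" "finite \<N>" "\<And>N. N \<in> \<N> \<Longrightarrow> negligible N"
  obtains y where "y \<in> U" "y \<notin> \<Union>\<N>"
proof -
  have "negligible (\<Union>\<N>)"
    using assms(3,4) by (rule negligible_Union)
  then have "\<not> U \<subseteq> \<Union>\<N>"
    using assms open_not_negligible negligible_subset by blast
  then show thesis
    using that by blast
qed

lemma negligible_affine_hull_card_le_DIM:
  fixes T :: "'a::euclidean_space set"
  assumes "finite T" "card T \<le> DIM('a)"
  shows "negligible (affine hull T)"
  using assms empty_interior_affine_hull negligible_convex_interior
  by (metis affine_affine_hull affine_imp_convex)

text \<open>A new point can only spoil independence by lying in the affine hull of at most three old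
  ones. These hulls are finitely many null sets, so they cannot cover the open set
  \<open>U\<close>.\<close>

lemma general_position_extend:
  assumes "finite S" "general_position S" "open U" "U \<noteq> {}"
  obtains y where "y \<in> U" "y \<notin> S" "general_position (insert y S)"
proof -
  define \<N> where "\<N> = (\<lambda>T. affine hull T) ` {T. T \<subseteq> S \<and> card T \<le> 3}"
  have "finite \<N>"
    using \<open>finite S\<close> by (simp add: \<N>_def)
  moreover have "negligible N" if "N \<in> \<N>" for N
    using that \<open>finite S\<close> finite_subset
    by (force simp: \<N>_def intro!: negligible_affine_hull_card_le_DIM)
  ultimately obtain y where y: "y \<in> U" "y \<notin> \<Union>\<N>"
    using open_not_covered_by_negligible assms by metis
  have nin: "y \<notin> affine hull T" if "T \<subseteq> S" "card T \<le> 3" for T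
    using that y(2) by (auto simp: \<N>_def)
  have "y \<notin> S"
    \<comment> \<open>If \<open>y\<close> were in \<open>S\<close>, the singleton \<open>{y}\<close>
      would be one of the avoided subsets.\<close>
    using nin[of "{y}"] by auto
  moreover have "general_position (insert y S)"
    unfolding general_position_def
  proof (intro allI impI, elim conjE)
    fix T assume T: "T \<subseteq> insert y S" "finite T" "card T \<le> 4"
    show "\<not> affine_dependent T"
    proof (cases "y \<in> T")
      case True
      have sub: "T - {y} \<subseteq> S" and card: "card (T - {y}) \<le> 3"
        using T True by auto
      then have "\<not> affine_dependent (T - {y})"
        using assms(2) T(2) by (auto simp: general_position_def)
      then have "\<not> affine_dependent (insert y (T - {y}))"
        using nin[OF sub card] affine_independent_insert by blast
      then show ?thesis
        using True by (simp add: insert_absorb)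
    next
      case False
      then show ?thesis
        using T assms(2) by (auto simp: general_position_def)
    qed
  qed
  ultimately show thesis
    using that y(1) by blast
qed

section \<open>Separation conditions and their stability\<close>

definition edges_separated :: "(real^3) set \<Rightarrow> (real^3 \<Rightarrow> real^3) \<Rightarrow> bool" where
  "edges_separated X y \<longleftrightarrow>
    (\<forall>i\<in>X. \<forall>j\<in>X. \<forall>k\<in>X. \<forall>l\<in>X. distinct [i, j, k, l] \<longrightarrow>
      (\<exists>a b. a \<bullet> i < b \<and> a \<bullet> y i < b \<and> a \<bullet> j < b \<and> a \<bullet> y j < b \<and>
             a \<bullet> k > b \<and> a \<bullet> y k > b \<and> a \<bullet> l > b \<and> a \<bullet> y l > b))"

text \<open>
  The separating plane through \<open>i\<close> and \<open>y i\<close> has normal \<open>cross3 (y i - i) c\<close>; this form makes it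
  depend continuously on \<open>y i\<close> for fixed \<open>c\<close>.
\<close>

definition wedges_separated :: "(real^3) set \<Rightarrow> (real^3 \<Rightarrow> real^3) \<Rightarrow> bool" where
  "wedges_separated X y \<longleftrightarrow>
    (\<forall>i\<in>X. \<forall>j\<in>X. \<forall>k\<in>X. distinct [i, j, k] \<longrightarrow>
      (\<exists>c. cross3 (y i - i) c \<bullet> (j - i) < 0 \<and> cross3 (y i - i) c \<bullet> (y j - i) < 0 \<and>
           cross3 (y i - i) c \<bullet> (k - i) > 0 \<and> cross3 (y i - i) c \<bullet> (y k - i) > 0))"

lemma tendsto_cross3:
  assumes "(f \<longlongrightarrow> u) F" "(g \<longlongrightarrow> v) F"
  shows "((\<lambda>z. cross3 (f z) (g z)) \<longlongrightarrow> cross3 u v) F"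
  unfolding cross3_def vector_def
  by (intro vec_tendstoI) (auto intro!: tendsto_intros assms simp: forall_3)

text \<open>Finitely many strict inequalities survive a small change of \<open>y\<close> with the
  same \<open>a\<close> and \<open>b\<close>. The filter is left general to cover both
  \<open>t\<close> tending to 0 from the right and the motion of a single partner.\<close>

lemma eventually_edges_separated:
  assumes "finite X" and lim: "\<And>p. p \<in> X \<Longrightarrow> ((\<lambda>z. Y z p) \<longlongrightarrow> y p) F"
    and sep: "edges_separated X y"
  shows "eventually (\<lambda>z. edges_separated X (Y z)) F"
  unfolding edges_separated_def
proof (intro eventually_ball_finite assms(1) ballI)
  fix i j k l assume X: "i \<in> X" "j \<in> X" "k \<in> X" "l \<in> X"
  show "\<forall>\<^sub>F z in F. distinct [i, j, k, l] \<longrightarrow>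
      (\<exists>a b. a \<bullet> i < b \<and> a \<bullet> Y z i < b \<and> a \<bullet> j < b \<and> a \<bullet> Y z j < b \<and>
             a \<bullet> k > b \<and> a \<bullet> Y z k > b \<and> a \<bullet> l > b \<and> a \<bullet> Y z l > b)"
  proof (cases "distinct [i, j, k, l]")
    case True
    then obtain a b where ab: "a \<bullet> i < b" "a \<bullet> y i < b" "a \<bullet> j < b" "a \<bullet> y j < b"
        "a \<bullet> k > b" "a \<bullet> y k > b" "a \<bullet> l > b" "a \<bullet> y l > b"
      using sep X unfolding edges_separated_def by blast
    have lim': "((\<lambda>z. a \<bullet> Y z p) \<longlongrightarrow> a \<bullet> y p) F" if "p \<in> X" for p
      by (intro tendsto_intros lim that)
    have "\<forall>\<^sub>F z in F. a \<bullet> Y z i < b \<and> a \<bullet> Y z j < b \<and> a \<bullet> Y z k > b \<and> a \<bullet> Y z l > b"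
      using ab X by (intro eventually_conj order_tendstoD[OF lim'])
    then show ?thesis
      by eventually_elim (use ab in blast)
  qed auto
qed

text \<open>The vector \<open>c\<close> is kept while the normal turns with \<open>Y z i\<close>.
  The plane thus still contains \<open>i\<close> and \<open>Y z i\<close>, and only strict
  inequalities have to persist.\<close>

lemma eventually_wedges_separated:
  assumes "finite X" and lim: "\<And>p. p \<in> X \<Longrightarrow> ((\<lambda>z. Y z p) \<longlongrightarrow> y p) F"
    and sep: "wedges_separated X y"
  shows "eventually (\<lambda>z. wedges_separated X (Y z)) F"
  unfolding wedges_separated_def
proof (intro eventually_ball_finite assms(1) ballI)
  fix i j k assume X: "i \<in> X" "j \<in> X" "k \<in> X"
  show "\<forall>\<^sub>F z in F. distinct [i, j, k] \<longrightarrow>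
      (\<exists>c. cross3 (Y z i - i) c \<bullet> (j - i) < 0 \<and> cross3 (Y z i - i) c \<bullet> (Y z j - i) < 0 \<and>
           cross3 (Y z i - i) c \<bullet> (k - i) > 0 \<and> cross3 (Y z i - i) c \<bullet> (Y z k - i) > 0)"
  proof (cases "distinct [i, j, k]")
    case True
    then obtain c where c: 
        "cross3 (y i - i) c \<bullet> (j - i) < 0" "cross3 (y i - i) c \<bullet> (y j - i) < 0"
        "cross3 (y i - i) c \<bullet> (k - i) > 0" "cross3 (y i - i) c \<bullet> (y k - i) > 0"
      using sep X unfolding wedges_separated_def by blast
    have lim': "((\<lambda>z. cross3 (Y z i - i) c \<bullet> (f z - i)) \<longlongrightarrow> cross3 (y i - i) c \<bullet> (p - i)) F"
      if "(f \<longlongrightarrow> p) F" for f p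
      by (intro tendsto_intros tendsto_cross3 lim that X)
    have "\<forall>\<^sub>F z in F. cross3 (Y z i - i) c \<bullet> (j - i) < 0 \<and> cross3 (Y z i - i) c \<bullet> (Y z j - i) < 0 \<and>
           cross3 (Y z i - i) c \<bullet> (k - i) > 0 \<and> cross3 (Y z i - i) c \<bullet> (Y z k - i) > 0"
      using c X
      by (intro eventually_conj order_tendstoD(2)[OF lim'[OF tendsto_const]]
          order_tendstoD(1)[OF lim'[OF tendsto_const]]
          order_tendstoD(2)[OF lim'[OF lim]] order_tendstoD(1)[OF lim'[OF lim]])
    then show ?thesis
      by eventually_elim blast
  qed auto
qed

section \<open>Existence of separated partners\<close>

lemma edges_separated_id:
  assumes "general_position X"
  shows "edges_separated X (\<lambda>p. p)"
  unfolding edges_separated_def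
proof (intro ballI impI)
  fix i j k l assume X: "i \<in> X" "j \<in> X" "k \<in> X" "l \<in> X" and d: "distinct [i, j, k, l]"
  have "\<not> affine_dependent {i, j, k, l}"
    using assms X d by (auto simp: general_position_def)
  then have "\<not> affine_dependent ({i, j} \<union> {k, l})"
    by (simp add: insert_commute)
  \<comment> \<open>Opposite edges of a nondegenerate tetrahedron do not meet.\<close>
  then have "convex hull {i, j} \<inter> convex hull {k, l} = convex hull ({i, j} \<inter> {k, l})"
    by (rule convex_hull_Int[symmetric])
  also have "{i, j} \<inter> {k, l} = {}"
    using d by auto
  finally have "convex hull {i, j} \<inter> convex hull {k, l} = {}"
    by simp
  then obtain a b where ab: "\<forall>x\<in>convex hull {i, j}. a \<bullet> x < b"
      "\<forall>x\<in>convex hull {k, l}. b < a \<bullet> x"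
    using separating_hyperplane_compact_closed[of "convex hull {i, j}" "convex hull {k, l}"]
    by (auto simp: finite_imp_compact_convex_hull compact_imp_closed)
  have "a \<bullet> i < b" "a \<bullet> j < b" "b < a \<bullet> k" "b < a \<bullet> l"
    by (auto intro!: ab[rule_format] hull_inc)
  then show "\<exists>a b. a \<bullet> i < b \<and> a \<bullet> i < b \<and> a \<bullet> j < b \<and> a \<bullet> j < b \<and>
             a \<bullet> k > b \<and> a \<bullet> k > b \<and> a \<bullet> l > b \<and> a \<bullet> l > b"
    by blast
qed

lemma general_position_cross3_nonzero:
  assumes "general_position X" "i \<in> X" "j \<in> X" "k \<in> X" "distinct [i, j, k]"
  shows "cross3 (j - i) (k - i) \<noteq> 0"
proof -
  have "\<not> affine_dependent {j, i, k}"
    using assms by (auto simp: general_position_def)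
  then have "\<not> collinear {j, i, k}"
    using assms(5) by (auto simp: collinear_3_eq_affine_dependent)
  then have "\<not> collinear {0, j - i, k - i}"
    using collinear_3[unfolded NO_MATCH_def, OF TrueI, of j i k] by blast
  then show ?thesis
    by (simp add: cross_eq_0)
qed

text \<open>For each pair \<open>j\<close>, \<open>k\<close> the bad directions form the plane
  through 0 with normal \<open>cross3 (j - i) (k - i)\<close>, which is nonzero by general position.
  Finitely many planes do not fill space.\<close>

lemma transversal_direction:
  assumes "finite X" "general_position X" "i \<in> X"
  obtains d where "\<And>j k. j \<in> X \<Longrightarrow> k \<in> X \<Longrightarrow> distinct [i, j, k] \<Longrightarrow>
    cross3 d (j - i) \<bullet> (k - i) \<noteq> 0"
proof -
  define \<N> where "\<N> = (\<lambda>(j, k). {d. cross3 (j - i) (k - i) \<bullet> d = 0}) `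
    {p \<in> X \<times> X. distinct [i, fst p, snd p]}"
  have "finite \<N>"
    using assms by (simp add: \<N>_def)
  moreover have "negligible N" if "N \<in> \<N>" for N
    using that general_position_cross3_nonzero[OF assms(2,3)]
    by (auto simp: \<N>_def intro!: negligible_hyperplane)
  ultimately obtain d where d: "d \<notin> \<Union>\<N>"
    using open_not_covered_by_negligible[of UNIV \<N>] by auto
  have "cross3 d (j - i) \<bullet> (k - i) \<noteq> 0" if "j \<in> X" "k \<in> X" "distinct [i, j, k]" for j k
  proof -
    have "cross3 (j - i) (k - i) \<bullet> d \<noteq> 0"
      using d that unfolding \<N>_def by force
    then show ?thesis
      by (subst cross_triple)
  qed
  then show thesis
    using that by blast
qed

text \<open>The normal at \<open>i\<close> is \<open>t\<close> times a fixed vector, so for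
  \<open>t > 0\<close> the signs at \<open>j\<close> and \<open>k\<close> do not depend on
  \<open>t\<close>; small \<open>t\<close> carries them over to the partners. At
  \<open>t = 0\<close> the normal vanishes, hence the one-sided filter.\<close>

lemma eventually_wedges_separated_translates:
  assumes "finite X"
    and d: "\<And>i j k. i \<in> X \<Longrightarrow> j \<in> X \<Longrightarrow> k \<in> X \<Longrightarrow> distinct [i, j, k] \<Longrightarrow>
      cross3 (d i) (j - i) \<bullet> (k - i) \<noteq> 0"
  shows "\<forall>\<^sub>F t in at_right 0. wedges_separated X (\<lambda>p. p + t *\<^sub>R d p)"
  unfolding wedges_separated_def
proof (intro eventually_ball_finite assms(1) ballI)
  fix i j k assume X: "i \<in> X" "j \<in> X" "k \<in> X"
  let ?y = "\<lambda>t p. p + t *\<^sub>R d p"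
  show "\<forall>\<^sub>F t in at_right 0. distinct [i, j, k] \<longrightarrow>
      (\<exists>c. cross3 (?y t i - i) c \<bullet> (j - i) < 0 \<and> cross3 (?y t i - i) c \<bullet> (?y t j - i) < 0 \<and>
           cross3 (?y t i - i) c \<bullet> (k - i) > 0 \<and> cross3 (?y t i - i) c \<bullet> (?y t k - i) > 0)"
  proof (cases "distinct [i, j, k]")
    case True
    define r where "r = cross3 (d i) (j - i) \<bullet> (k - i)"
    have "r \<noteq> 0"
      using d X True by (simp add: r_def)
    \<comment> \<open>The plane spanned by \<open>d i\<close> and \<open>(j - i) + (k - i)\<close> has \<open>j\<close> and \<open>k\<close> on opposite sides.\<close>
    define c where "c = r *\<^sub>R ((j - i) + (k - i))"
    have skew: "cross3 (d i) (k - i) \<bullet> (j - i) = - r"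
      unfolding r_def by (simp add: cross3_simps)
    \<comment> \<open>The factor \<open>r\<close> in \<open>c\<close> turns the triple product into
      a square, so the signs are the same for either orientation of \<open>d i\<close>,
      \<open>j - i\<close>, \<open>k - i\<close>.\<close>
    have cj: "cross3 (d i) c \<bullet> (j - i) = - (r * r)"
      by (simp only: c_def cross_mult_right cross_add_right inner_scaleR_left inner_add_left skew)
        (simp add: dot_cross_self)
    have ck: "cross3 (d i) c \<bullet> (k - i) = r * r"
      by (simp only: c_def cross_mult_right cross_add_right inner_scaleR_left inner_add_left)
        (simp add: dot_cross_self r_def)
    have neg: "cross3 (d i) c \<bullet> (j - i) < 0" and pos: "0 < cross3 (d i) c \<bullet> (k - i)"
      using \<open>r \<noteq> 0\<close> by (auto simp: cj ck not_sum_squares_lt_zero zero_less_mult_iff)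
    have lim: "((\<lambda>t. cross3 (d i) c \<bullet> (?y t p - i)) \<longlongrightarrow> cross3 (d i) c \<bullet> (p + 0 *\<^sub>R d p - i))
        (at_right 0)" for p
      by (intro tendsto_intros)
    have "\<forall>\<^sub>F t in at_right 0. cross3 (d i) c \<bullet> (?y t j - i) < 0 \<and> 0 < cross3 (d i) c \<bullet> (?y t k - i)"
      using neg pos by (intro eventually_conj order_tendstoD[OF lim]) auto
    moreover have "\<forall>\<^sub>F t in at_right 0. (0::real) < t"
      by (simp add: eventually_at_right_less)
    ultimately show ?thesis
    proof eventually_elim
      case (elim t)
      have "cross3 (?y t i - i) c \<bullet> v = t * (cross3 (d i) c \<bullet> v)" for v
        by (simp add: cross_mult_left)
      then show ?case
        using elim neg pos by (intro impI exI[of _ c]) (simp add: mult_pos_neg)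
    qed
  qed auto
qed

text \<open>The edge condition holds in the degenerate case where each point is its own partner and
  persists for small \<open>t\<close>; the wedge condition comes from the transversal directions.
  One small \<open>t > 0\<close> serves both.\<close>

lemma separated_exists:
  assumes "finite X" "general_position X"
  obtains y where "edges_separated X y" "wedges_separated X y"
proof -
  have "\<forall>i\<in>X. \<exists>d. \<forall>j\<in>X. \<forall>k\<in>X. distinct [i, j, k] \<longrightarrow> cross3 d (j - i) \<bullet> (k - i) \<noteq> 0"
    using transversal_direction[OF assms] by metis
  then obtain d where d: "\<And>i j k. i \<in> X \<Longrightarrow> j \<in> X \<Longrightarrow> k \<in> X \<Longrightarrow> distinct [i, j, k] \<Longrightarrow>
      cross3 (d i) (j - i) \<bullet> (k - i) \<noteq> 0"
    by metis
  have "((\<lambda>t. p + t *\<^sub>R d p) \<longlongrightarrow> p + 0 *\<^sub>R d p) (at_right 0)" for p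
    by (intro tendsto_intros)
  then have "\<forall>\<^sub>F t in at_right 0. edges_separated X (\<lambda>p. p + t *\<^sub>R d p)"
    using assms by (intro eventually_edges_separated[where y = "\<lambda>p. p"] edges_separated_id) auto
  then have "\<forall>\<^sub>F t in at_right 0. edges_separated X (\<lambda>p. p + t *\<^sub>R d p) \<and>
      wedges_separated X (\<lambda>p. p + t *\<^sub>R d p)"
    using eventually_wedges_separated_translates[OF assms(1) d] by (intro eventually_conj)
  then show thesis
    using that eventually_happens'[OF trivial_limit_at_right_real] by blast
qed

text \<open>Induction on the set \<open>A\<close> of points whose partners have already been
  adjusted: separation is maintained for all of \<open>X\<close>, general position only for
  \<open>X\<close> together with the partners of \<open>A\<close>.\<close>

lemma separated_general_position_exists:
  assumes "finite X" "general_position X"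
  obtains y where "edges_separated X y" "wedges_separated X y"
    "general_position (X \<union> y ` X)" "inj_on y X" "X \<inter> y ` X = {}"
proof -
  have "\<exists>y. edges_separated X y \<and> wedges_separated X y \<and>
      general_position (X \<union> y ` A) \<and> inj_on y A \<and> X \<inter> y ` A = {}" if "A \<subseteq> X" for A
    using finite_subset[OF that assms(1)] that
  proof (induction A rule: finite_induct)
    case empty
    show ?case
      using separated_exists[OF assms] assms(2) by auto
  next
    case (insert i A)
    then obtain y where y: "edges_separated X y" "wedges_separated X y"
        "general_position (X \<union> y ` A)" "inj_on y A" "X \<inter> y ` A = {}"
      by auto
    \<comment> \<open>Only the partner of \<open>i\<close> moves; stability then gives a whole
      neighbourhood \<open>U\<close> of admissible positions.\<close>
    have lim: "((\<lambda>z. (y(i := z)) p) \<longlongrightarrow> y p) (nhds (y i))" for p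
      by (cases "p = i") (auto intro: filterlim_ident)
    have "\<forall>\<^sub>F z in nhds (y i). edges_separated X (y(i := z)) \<and> wedges_separated X (y(i := z))"
      using assms(1) y lim
      by (intro eventually_conj eventually_edges_separated[where y = y]
          eventually_wedges_separated[where y = y])
    then obtain U where U: "open U" "y i \<in> U"
        "\<And>z. z \<in> U \<Longrightarrow> edges_separated X (y(i := z)) \<and> wedges_separated X (y(i := z))"
      by (auto simp: eventually_nhds)
    have "finite (X \<union> y ` A)"
      using assms(1) insert.hyps by auto
    then obtain z where z: "z \<in> U" "z \<notin> X \<union> y ` A" "general_position (insert z (X \<union> y ` A))"
      using general_position_extend[OF _ y(3) U(1)] U(2) by blast
    have im: "y(i := z) ` insert i A = insert z (y ` A)"
      using insert.hyps by auto
    have "inj_on (y(i := z)) (insert i A)"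
      using insert.hyps y(4) z(2) by (auto simp: inj_on_def)
    moreover have "general_position (X \<union> y(i := z) ` insert i A)"
      using z(3) unfolding im by simp
    moreover have "X \<inter> y(i := z) ` insert i A = {}"
      using z(2) y(5) unfolding im by auto
    ultimately show ?case
      using U(3)[OF z(1)] by blast
  qed
  then show thesis
    using that by blast
qed

section \<open>From separating planes to disjoint interiors\<close>

lemma interior_convex_hulls_disjoint:
  fixes a :: "'a::euclidean_space"
  assumes "a \<noteq> 0" "\<And>x. x \<in> A \<Longrightarrow> a \<bullet> x \<le> b" "\<And>x. x \<in> B \<Longrightarrow> b \<le> a \<bullet> x"
  shows "interior (convex hull A) \<inter> interior (convex hull B) = {}"
proof -
  have "convex hull A \<subseteq> {x. a \<bullet> x \<le> b}" "convex hull B \<subseteq> {x. a \<bullet> x \<ge> b}"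
    using assms(2,3) by (intro hull_minimal convex_halfspace_le convex_halfspace_ge; blast)+
  \<comment> \<open>Since \<open>a \<noteq> 0\<close>, a closed half-space has the open one as
    interior, so the hulls may touch along the plane.\<close>
  then have "interior (convex hull A) \<subseteq> {x. a \<bullet> x < b}" "interior (convex hull B) \<subseteq> {x. a \<bullet> x > b}"
    using assms(1) interior_mono
    by (metis interior_halfspace_le, metis interior_halfspace_ge)
  then show ?thesis
    by fastforce
qed

lemma interior_disjoint_of_separated:
  assumes "edges_separated X y" "wedges_separated X y"
    and "T \<subseteq> X" "card T = 2" "T' \<subseteq> X" "card T' = 2" "T \<noteq> T'"
  shows "interior (convex hull (T \<union> y ` T)) \<inter> interior (convex hull (T' \<union> y ` T')) = {}"
proof (cases "T \<inter> T' = {}")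
  case True
  obtain i j where T: "T = {i, j}" "i \<noteq> j"
    using assms(4) by (auto simp: card_2_iff)
  obtain k l where T': "T' = {k, l}" "k \<noteq> l"
    using assms(6) by (auto simp: card_2_iff)
  have "distinct [i, j, k, l]" "i \<in> X" "j \<in> X" "k \<in> X" "l \<in> X"
    using T T' True assms by auto
  then obtain a b where ab: "a \<bullet> i < b" "a \<bullet> y i < b" "a \<bullet> j < b" "a \<bullet> y j < b"
        "a \<bullet> k > b" "a \<bullet> y k > b" "a \<bullet> l > b" "a \<bullet> y l > b"
    using assms(1) unfolding edges_separated_def by blast
  then have "a \<noteq> 0"
    by auto
  then show ?thesis
    by (rule interior_convex_hulls_disjoint[where b = b]) (use ab T T' in auto)
next
  case False
  then obtain i where i: "i \<in> T" "i \<in> T'"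
    by auto
  obtain j where T: "T = {i, j}" "i \<noteq> j"
    using assms(4) i by (auto simp: card_2_iff)
  obtain k where T': "T' = {i, k}" "i \<noteq> k"
    using assms(6) i by (auto simp: card_2_iff)
  have "distinct [i, j, k]" "i \<in> X" "j \<in> X" "k \<in> X"
    using T T' assms by auto
  then obtain c where c:
        "cross3 (y i - i) c \<bullet> (j - i) < 0" "cross3 (y i - i) c \<bullet> (y j - i) < 0"
        "cross3 (y i - i) c \<bullet> (k - i) > 0" "cross3 (y i - i) c \<bullet> (y k - i) > 0"
    using assms(2) unfolding wedges_separated_def by blast
  define a where "a = cross3 (y i - i) c"
  \<comment> \<open>The plane contains the edge from \<open>i\<close> to \<open>y i\<close> shared
    by both tetrahedra.\<close>
  have "a \<bullet> (y i - i) = 0"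
    by (simp add: a_def dot_cross_self)
  with c have "a \<bullet> y i = a \<bullet> i" "a \<bullet> j < a \<bullet> i" "a \<bullet> y j < a \<bullet> i" "a \<bullet> k > a \<bullet> i" "a \<bullet> y k > a \<bullet> i"
    by (auto simp: a_def[symmetric] inner_diff_right)
  moreover from this have "a \<noteq> 0"
    by auto
  ultimately show ?thesis
    by (intro interior_convex_hulls_disjoint[where a = a and b = "a \<bullet> i"]) (use T T' in auto)
qed

theorem theorem34:
  fixes X :: "(real ^ 3) set" and n :: nat
  assumes "finite X" and "card X = n" and "general_position X"
  shows "\<exists>S. X \<subseteq> S \<and> finite S \<and> card S = 2 * n \<and> general_position S \<and>
    (\<exists>F \<subseteq> simplices_on S. finite F \<and> card F \<ge> n choose 2 \<and>
       pairwise (\<lambda>\<sigma> \<tau>. interior \<sigma> \<inter> interior \<tau> = {}) F)"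
proof -
  obtain y where y: "edges_separated X y" "wedges_separated X y"
    "general_position (X \<union> y ` X)" "inj_on y X" "X \<inter> y ` X = {}"
    using separated_general_position_exists[OF assms(1,3)] by blast
  define S where "S = X \<union> y ` X"
  define P where "P = {T. T \<subseteq> X \<and> card T = 2}"
  define tet where "tet T = convex hull (T \<union> y ` T)" for T
  have "finite S" "card S = 2 * n"
    using assms y(4,5) by (auto simp: S_def card_Un_disjoint card_image)
  have verts: "T \<union> y ` T \<subseteq> S" "card (T \<union> y ` T) = 4" "\<not> affine_dependent (T \<union> y ` T)"
    if "T \<in> P" for T
  proof -
    have T: "T \<subseteq> X" "card T = 2" "finite T"
      using that assms(1) finite_subset by (auto simp: P_def)
    have "card (y ` T) = 2"
      using T y(4) by (metis card_image inj_on_subset)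
    moreover have "T \<inter> y ` T = {}"
      using T y(5) by blast
    ultimately show "card (T \<union> y ` T) = 4"
      using T by (simp add: card_Un_disjoint)
    moreover show "T \<union> y ` T \<subseteq> S"
      using T by (auto simp: S_def)
    ultimately show "\<not> affine_dependent (T \<union> y ` T)"
      using y(3) T(3) unfolding general_position_def S_def by simp
  qed
  have disj: "interior (tet T) \<inter> interior (tet T') = {}" if "T \<in> P" "T' \<in> P" "T \<noteq> T'" for T T'
    using that interior_disjoint_of_separated[OF y(1,2)] unfolding P_def tet_def by blast
  have "interior (tet T) \<noteq> {}" if "T \<in> P" for T
    using verts[OF that] interior_convex_hull_eq_empty[of "T \<union> y ` T"] by (simp add: tet_def)
  \<comment> \<open>Two pairs with the same tetrahedron would make its nonempty interior disjoint
    from itself; hence there are as many tetrahedra as pairs.\<close>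
  then have "inj_on tet P"
    using disj unfolding inj_on_def by (metis Int_absorb)
  then have "card (tet ` P) = n choose 2"
    using n_subsets[OF assms(1), of 2] assms(2) by (simp add: card_image P_def)
  moreover have "finite (tet ` P)"
    using assms(1) by (simp add: P_def)
  moreover have "tet ` P \<subseteq> simplices_on S"
    using verts unfolding simplices_on_def tet_def by blast
  moreover have "pairwise (\<lambda>\<sigma> \<tau>. interior \<sigma> \<inter> interior \<tau> = {}) (tet ` P)"
    using disj by (auto simp: pairwise_def)
  ultimately show ?thesis
    using \<open>finite S\<close> \<open>card S = 2 * n\<close> y(3)
    by (intro exI[of _ S] conjI exI[of _ "tet ` P"]) (auto simp: S_def)
qed

end
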